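(* Let $k$ be a field equipped with the identity conjugation, let $D_1,D_2,D_3\in k$, and define $k_0=k$ and $k_i=k_{i-1}\times_{D_i}k_{i-1}$ for $i=1,2,3$. Then the norms on the $k$-algebras $k_1$, $k_2$ and $k_3$ are multiplicative, that is, $n(ab)=n(a)n(b)$ for all $a,b\in k_i$, $i=1,2,3$.
   Context: Let $k$ be a field. A $k$-algebra $K$ (not assumed commutative, associative or distributive) is a left $k$-vector space equipped with a multiplication and a multiplicative identity $1$ such that: $k$ is a subset of the center of $K$, and the additive and multiplicative structure on $k$ is the restriction of that on $K$; and $a(bc)=(ab)c$ for $a,b,c\in K$ whenever at least one of $a,b,c$ belongs to $k$. A conjugation on $K$ is a self-inverse $k$-linear map $\overline{\phantom{a}}:K\to K$ restricting to the identity on $k$. The norm is $n(a)=\overline{a}a$. Given a $k$-algebra $K$ with conjugation and $D\in k$, the Cayley-Dickson double $K\times_D K$ is the $k$-vector space $K\times K$ with conjugation $\overline{(a,b)}=(\overline{a},-b)$ and multiplication $(a,b)(c,d)=(ac+Dd\overline{b},\ \overline{a}d+cb)$ for $a,b,c,d\in K$. It is a $k$-algebra with identity $(1,0)$; $K$ (and hence $k$) is regarded as contained in it via $a\mapsto(a,0)$. *)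

theory Defs
  imports Complex_Main "HOL-Library.Product_Plus"
begin

record ('k, 'v) conj_alg =
  scal :: "'k \<Rightarrow> 'v \<Rightarrow> 'v"
  mul :: "'v \<Rightarrow> 'v \<Rightarrow> 'v"
  unit :: "'v"
  conjg :: "'v \<Rightarrow> 'v"

definition incl :: "('k, 'v) conj_alg \<Rightarrow> 'k \<Rightarrow> 'v" where
  "incl K c = scal K c (unit K)"

text \<open>
  Neither commutativity, nor associativity, nor distributivity of \<^term>\<open>mul K\<close> is required.
  That \<^term>\<open>incl K\<close> respects addition and multiplication follows from the vector space axioms
  and \<open>mul_incl\<close>, which says that multiplication by a scalar in the algebra is the scalar
  multiplication of the vector space.
\<close>

locale k_conj_algebra = vector_space "scal K"
  for K :: "('k::field, 'v::ab_group_add) conj_alg" +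
  assumes unit_left: "mul K (unit K) a = a"
    and unit_right: "mul K a (unit K) = a"
    and inj_incl: "inj (incl K)"
    and mul_incl: "mul K (incl K c) a = scal K c a"
    and incl_central: "mul K (incl K c) a = mul K a (incl K c)"
    and assoc_scalar: "x \<in> range (incl K) \<or> y \<in> range (incl K) \<or> z \<in> range (incl K) \<Longrightarrow>
      mul K x (mul K y z) = mul K (mul K x y) z"
    and conjg_linear: "Vector_Spaces.linear (scal K) (scal K) (conjg K)"
    and conjg_conjg: "conjg K (conjg K a) = a"
    and conjg_incl: "conjg K (incl K c) = incl K c"

definition nrm :: "('k, 'v) conj_alg \<Rightarrow> 'v \<Rightarrow> 'v" where
  "nrm K a = mul K (conjg K a) a"

definition base_field :: "('k::field, 'k) conj_alg" where
  "base_field = \<lparr> scal = (*), mul = (*), unit = 1, conjg = (\<lambda>a. a) \<rparr>"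

definition cd_double ::
  "('k::field, 'v::ab_group_add) conj_alg \<Rightarrow> 'k \<Rightarrow> ('k, 'v \<times> 'v) conj_alg" where
  "cd_double K D = \<lparr>
     scal = (\<lambda>r (a, b). (scal K r a, scal K r b)),
     mul = (\<lambda>(a, b) (c, d).
       (mul K a c + scal K D (mul K d (conjg K b)), mul K (conjg K a) d + mul K c b)),
     unit = (unit K, 0),
     conjg = (\<lambda>(a, b). (conjg K a, - b)) \<rparr>"

lemma k_conj_algebra_base_field: "k_conj_algebra (base_field :: ('k::field, 'k) conj_alg)"
proof -
  have vs: "vector_space (scal (base_field :: ('k, 'k) conj_alg))"
    by unfold_locales (auto simp: base_field_def algebra_simps)
  show ?thesis
  proof (rule k_conj_algebra.intro[OF vs], rule k_conj_algebra_axioms.intro)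
    show "Vector_Spaces.linear (scal base_field) (scal base_field)
        (conjg (base_field :: ('k, 'k) conj_alg))"
      unfolding Vector_Spaces.linear_iff using vs by (auto simp: base_field_def)
  qed (auto simp: base_field_def incl_def inj_def)
qed

lemma k_conj_algebra_cd_double:
  assumes "k_conj_algebra K"
  shows "k_conj_algebra (cd_double K D)"
proof -
  interpret k_conj_algebra K by fact
  interpret cn: Vector_Spaces.linear "scal K" "scal K" "conjg K" by (rule conjg_linear)
  have mi: "mul K a (incl K c) = scal K c a" for a c
    using incl_central mul_incl by metis
  have s1: "mul K (scal K r a) b = scal K r (mul K a b)" for r a b
    using assoc_scalar[of "incl K r" a b] by (simp add: mul_incl)
  have s2: "mul K a (scal K r b) = scal K r (mul K a b)" for r a b
    using assoc_scalar[of a b "incl K r"] by (simp add: mi)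
  have z1: "mul K 0 a = 0" for a
    using s1[of 0 0 a] by simp
  have z2: "mul K a 0 = 0" for a
    using s2[of a 0 0] by simp
  have incl: "incl (cd_double K D) c = (incl K c, 0)" for c
    by (simp add: incl_def cd_double_def)
  have ops: "scal (cd_double K D) r (a, b) = (scal K r a, scal K r b)"
    "mul (cd_double K D) (a, b) (c, d) =
      (mul K a c + scal K D (mul K d (conjg K b)), mul K (conjg K a) d + mul K c b)"
    "unit (cd_double K D) = (unit K, 0)"
    "conjg (cd_double K D) (a, b) = (conjg K a, - b)" for r a b c d
    by (simp_all add: cd_double_def)
  note simps = ops mul_incl mi s1 s2 z1 z2 scale_right_distrib scale_left_distrib
    cn.add cn.scale cn.zero conjg_incl conjg_conjg unit_left unit_right
  have cu: "conjg K (unit K) = unit K"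
    using conjg_incl[of 1] by (simp add: incl_def)
  have vs: "vector_space (scal (cd_double K D))"
    by unfold_locales (auto simp: simps)
  show ?thesis
  proof (rule k_conj_algebra.intro[OF vs], rule k_conj_algebra_axioms.intro)
    show "inj (incl (cd_double K D))"
      using inj_incl by (simp add: incl inj_def)
    show "Vector_Spaces.linear (scal (cd_double K D)) (scal (cd_double K D)) (conjg (cd_double K D))"
      unfolding Vector_Spaces.linear_iff using vs by (auto simp: simps)
    fix x y z
    assume "x \<in> range (incl (cd_double K D)) \<or> y \<in> range (incl (cd_double K D)) \<or>
      z \<in> range (incl (cd_double K D))"
    then show "mul (cd_double K D) x (mul (cd_double K D) y z) =
      mul (cd_double K D) (mul (cd_double K D) x y) z"
      by (cases x; cases y; cases z) (auto simp: incl simps mult.commute)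
  qed (auto simp: incl simps cu)
qed

end

theory Submission
  imports Defs
begin

text \<open>
  Call an algebra with conjugation quadratic if its multiplication is distributive, its conjugation
  reverses products and its norms are scalars. Polarising \<open>n(a)\<close> with \<open>1\<close> shows that \<open>a + a'\<close> is
  a scalar, where \<open>a'\<close> is the conjugate of \<open>a\<close>; hence \<open>a\<close> commutes with \<open>a'\<close>, and so
  \<open>n(a, b) = n(a) - D n(b)\<close> in a double. If \<open>K\<close> is moreover associative, \<open>n\<close> is multiplicative on \<open>K\<close>,
  and \<open>n((a, b) (c, d)) - n(a, b) n(c, d)\<close> is \<open>D\<close> times the difference between \<open>w b' + b w'\<close> and
  \<open>b' w + w' b\<close> for \<open>w = c' a' d\<close>; this vanishes, as the polarisation of \<open>x x' = x' x\<close>.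
  So the norm of a double is multiplicative as soon as \<open>K\<close> is associative. A double of a commutative
  associative algebra is associative, so \<open>k\<^sub>0\<close>, \<open>k\<^sub>1\<close>, \<open>k\<^sub>2\<close> all are.
\<close>

context k_conj_algebra
begin

abbreviation mult (infixl "\<cdot>" 70) where "a \<cdot> b \<equiv> mul K a b"

lemma mul_incl_right: "a \<cdot> incl K c = scal K c a"
  using incl_central mul_incl by metis

text \<open>Scaling by \<open>r\<close> is multiplication by \<open>incl K r\<close>, so
  associativity for triples containing a scalar moves the factor out.\<close>

lemma mul_scale_left: "scal K r a \<cdot> b = scal K r (a \<cdot> b)"
  using assoc_scalar[of "incl K r" a b] by (simp add: mul_incl)

lemma mul_scale_right: "a \<cdot> scal K r b = scal K r (a \<cdot> b)"
  using assoc_scalar[of a b "incl K r"] by (simp add: mul_incl_right)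

text \<open>Distributivity is not among the axioms of \<open>k_conj_algebra\<close>, so zero is
  treated as a scalar multiple; signs below are treated likewise, as scaling by
  \<open>- 1\<close>.\<close>

lemma mul_zero_left: "0 \<cdot> a = 0"
  using mul_scale_left[of 0 0 a] by simp

lemma mul_zero_right: "a \<cdot> 0 = 0"
  using mul_scale_right[of a 0 0] by simp

lemma mul_minus_left: "(- a) \<cdot> b = - (a \<cdot> b)"
  using mul_scale_left[of "- 1" a b] by simp

lemma mul_minus_right: "a \<cdot> (- b) = - (a \<cdot> b)"
  using mul_scale_right[of a "- 1" b] by simp

lemma conjg_add: "conjg K (a + b) = conjg K a + conjg K b"
  using conjg_linear by (simp add: Vector_Spaces.linear_iff)

lemma conjg_scale: "conjg K (scal K r a) = scal K r (conjg K a)"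
  using conjg_linear by (simp add: Vector_Spaces.linear_iff)

lemma conjg_minus: "conjg K (- a) = - conjg K a"
  using conjg_scale[of "- 1" a] by simp

lemma conjg_unit: "conjg K (unit K) = unit K"
  using conjg_incl[of 1] by (simp add: incl_def)

end

text \<open>Nothing is assumed of \<open>K\<close> here, so \<open>scal K x 0\<close> cannot yet be
  replaced by \<open>0\<close>.\<close>

lemma cd_double_simps:
  "scal (cd_double K D) r (a, b) = (scal K r a, scal K r b)"
  "mul (cd_double K D) (a, b) (c, d) =
    (mul K a c + scal K D (mul K d (conjg K b)), mul K (conjg K a) d + mul K c b)"
  "unit (cd_double K D) = (unit K, 0)"
  "conjg (cd_double K D) (a, b) = (conjg K a, - b)"
  "incl (cd_double K D) x = (incl K x, scal K x 0)"
  by (simp_all add: cd_double_def incl_def)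

locale quadratic_conj_algebra = k_conj_algebra +
  assumes distrib_left: "mul K a (b + c) = mul K a b + mul K a c"
    and distrib_right: "mul K (a + b) c = mul K a c + mul K b c"
    and conjg_mul: "conjg K (mul K a b) = mul K (conjg K b) (conjg K a)"
    and nrm_scalar: "nrm K a \<in> range (incl K)"
begin

lemma distrib_diff_left: "a \<cdot> (b - c) = a \<cdot> b - a \<cdot> c"
  using distrib_left[of a b "- c"] by (simp add: mul_minus_right)

lemma distrib_diff_right: "(a - b) \<cdot> c = a \<cdot> c - b \<cdot> c"
  using distrib_right[of a "- b" c] by (simp add: mul_minus_left)

lemma trace_scalar: "a + conjg K a \<in> range (incl K)"
proof -
  obtain p q where p: "nrm K (a + unit K) = incl K p" and q: "nrm K a = incl K q"
    using nrm_scalar by (meson rangeE)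
  have "nrm K (a + unit K) = nrm K a + (a + conjg K a) + unit K"
    by (simp add: nrm_def conjg_add conjg_unit distrib_left distrib_right unit_left unit_right
        algebra_simps)
  then have "a + conjg K a = incl K (p - q - 1)"
    unfolding p q by (simp add: incl_def scale_left_diff_distrib algebra_simps)
  then show ?thesis by blast
qed

lemma mul_conjg_commute: "a \<cdot> conjg K a = conjg K a \<cdot> a"
proof -
  obtain t where t: "a + conjg K a = incl K t"
    using trace_scalar by blast
  \<comment> \<open>Scalars are central; after distributing, \<open>a \<cdot> a\<close> cancels from
    both sides.\<close>
  have "a \<cdot> (a + conjg K a) = (a + conjg K a) \<cdot> a"
    unfolding t by (rule incl_central[symmetric])
  then show ?thesis by (simp add: distrib_left distrib_right)
qed

lemma mul_conjg_commute_polarised: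
  "a \<cdot> conjg K b + b \<cdot> conjg K a = conjg K b \<cdot> a + conjg K a \<cdot> b"
  using mul_conjg_commute[of "a + b"] mul_conjg_commute[of a] mul_conjg_commute[of b]
  by (simp add: conjg_add distrib_left distrib_right algebra_simps)

lemma nrm_scale: "nrm K (scal K r a) = scal K (r * r) (nrm K a)"
  by (simp add: nrm_def conjg_scale mul_scale_left mul_scale_right)

lemma nrm_conjg: "nrm K (conjg K a) = nrm K a"
  by (simp add: nrm_def conjg_conjg mul_conjg_commute)

lemma nrm_add:
  "nrm K (a + b) = nrm K a + nrm K b + (conjg K a \<cdot> b + conjg K b \<cdot> a)"
  by (simp add: nrm_def conjg_add distrib_left distrib_right algebra_simps)

lemma nrm_cd_double: "nrm (cd_double K D) (a, b) = (nrm K a - scal K D (nrm K b), 0)"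
  by (simp add: nrm_def cd_double_simps conjg_conjg mul_minus_left mul_minus_right
      conjg_minus mul_conjg_commute)

lemma quadratic_cd_double: "quadratic_conj_algebra (cd_double K D)"
proof (rule quadratic_conj_algebra.intro, rule k_conj_algebra_cd_double,
    rule k_conj_algebra_axioms, rule quadratic_conj_algebra_axioms.intro)
  fix x y z :: "'b \<times> 'b"
  obtain a b c d e f where [simp]: "x = (a, b)" "y = (c, d)" "z = (e, f)"
    by (cases x; cases y; cases z)
  show "mul (cd_double K D) x (y + z) = mul (cd_double K D) x y + mul (cd_double K D) x z"
    by (simp add: cd_double_simps distrib_left distrib_right scale_right_distrib)
  show "mul (cd_double K D) (x + y) z = mul (cd_double K D) x z + mul (cd_double K D) y z"
    by (simp add: cd_double_simps distrib_left distrib_right scale_right_distrib conjg_add)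
  show "conjg (cd_double K D) (mul (cd_double K D) x y) =
    mul (cd_double K D) (conjg (cd_double K D) y) (conjg (cd_double K D) x)"
    by (simp add: cd_double_simps conjg_add conjg_scale conjg_mul conjg_conjg conjg_minus
        mul_minus_left mul_minus_right)
  obtain p q where "nrm K a = incl K p" "nrm K b = incl K q"
    using nrm_scalar by (meson rangeE)
  then have "nrm (cd_double K D) x = incl (cd_double K D) (p - D * q)"
    by (simp add: nrm_cd_double cd_double_simps incl_def scale_left_diff_distrib)
  then show "nrm (cd_double K D) x \<in> range (incl (cd_double K D))"
    by blast
qed

end

locale assoc_quadratic_conj_algebra = quadratic_conj_algebra +
  assumes mul_assoc: "mul K (mul K a b) c = mul K a (mul K b c)"
begin

text \<open>In \<open>b' (a' a) b\<close> the inner factor is a scalar and can be pulled out,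
  leaving \<open>n(a) n(b)\<close>.\<close>

lemma nrm_mul: "nrm K (a \<cdot> b) = nrm K a \<cdot> nrm K b"
proof -
  obtain p where p: "conjg K a \<cdot> a = incl K p"
    using nrm_scalar[of a] by (auto simp: nrm_def)
  have "nrm K (a \<cdot> b) = conjg K b \<cdot> ((conjg K a \<cdot> a) \<cdot> b)"
    by (simp add: nrm_def conjg_mul mul_assoc)
  also have "\<dots> = nrm K a \<cdot> nrm K b"
    by (simp add: nrm_def p mul_incl mul_scale_right)
  finally show ?thesis .
qed

lemma nrm_mul_commute: "nrm K a \<cdot> nrm K b = nrm K b \<cdot> nrm K a"
  using nrm_scalar[of a] by (auto simp: incl_central)

lemma nrm_cd_double_mul:
  "nrm (cd_double K D) (mul (cd_double K D) x y) =
    mul (cd_double K D) (nrm (cd_double K D) x) (nrm (cd_double K D) y)"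
proof -
  obtain a b c d where xy: "x = (a, b)" "y = (c, d)"
    by (cases x; cases y)
  \<comment> \<open>By associativity the cross terms of \<open>n(a c + D d b')\<close> are
    \<open>D (w b' + b w')\<close>, and those of \<open>n(a' d + c b)\<close> are
    \<open>b' w + w' b\<close>.\<close>
  define w where "w = conjg K c \<cdot> conjg K a \<cdot> d"
  define t where "t = w \<cdot> conjg K b + b \<cdot> conjg K w"
  have t': "t = conjg K b \<cdot> w + conjg K w \<cdot> b"
    unfolding t_def by (rule mul_conjg_commute_polarised)
  have "nrm K (a \<cdot> c + scal K D (d \<cdot> conjg K b)) =
      nrm K a \<cdot> nrm K c + scal K (D * D) (nrm K b \<cdot> nrm K d) + scal K D t"
    by (simp add: nrm_add nrm_scale nrm_mul nrm_conjg t_def w_def conjg_mul conjg_conjg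
        conjg_scale mul_assoc mul_scale_left mul_scale_right scale_right_distrib
        nrm_mul_commute[of d b])
  moreover have "nrm K (conjg K a \<cdot> d + c \<cdot> b) =
      nrm K a \<cdot> nrm K d + nrm K b \<cdot> nrm K c + t"
    by (simp add: nrm_add nrm_mul nrm_conjg t' w_def conjg_mul conjg_conjg mul_assoc
        nrm_mul_commute[of c b] algebra_simps)
  moreover have "(nrm K a - scal K D (nrm K b)) \<cdot> (nrm K c - scal K D (nrm K d)) =
      nrm K a \<cdot> nrm K c + scal K (D * D) (nrm K b \<cdot> nrm K d)
      - scal K D (nrm K a \<cdot> nrm K d + nrm K b \<cdot> nrm K c)"
    by (simp add: distrib_diff_left distrib_diff_right mul_scale_left mul_scale_right
        scale_right_distrib scale_right_diff_distrib algebra_simps)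
  \<comment> \<open>By \<open>nrm_cd_double\<close> the second expansion enters with factor
    \<open>- D\<close>, so the two terms \<open>scal K D t\<close> cancel.\<close>
  ultimately show ?thesis
    by (simp add: xy cd_double_simps nrm_cd_double mul_zero_left mul_zero_right
        scale_right_distrib algebra_simps)
qed

lemma assoc_quadratic_cd_double:
  assumes "\<And>a b. a \<cdot> b = b \<cdot> a"
  shows "assoc_quadratic_conj_algebra (cd_double K D)"
proof (rule assoc_quadratic_conj_algebra.intro, rule quadratic_cd_double,
    rule assoc_quadratic_conj_algebra_axioms.intro)
  \<comment> \<open>Together with commutativity and associativity, this lets rewriting sort every
    product into a normal form.\<close>
  have lc: "a \<cdot> (b \<cdot> c) = b \<cdot> (a \<cdot> c)" for a b c
    using assms mul_assoc by metis
  fix x y z :: "'b \<times> 'b"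
  obtain a b c d e f where xyz: "x = (a, b)" "y = (c, d)" "z = (e, f)"
    by (cases x; cases y; cases z)
  show "mul (cd_double K D) (mul (cd_double K D) x y) z =
    mul (cd_double K D) x (mul (cd_double K D) y z)"
    by (simp add: xyz cd_double_simps distrib_left distrib_right conjg_add conjg_scale conjg_mul
        conjg_conjg mul_scale_left mul_scale_right scale_right_distrib mul_assoc assms lc
        add_ac)
qed

end

lemma assoc_quadratic_base_field:
  "assoc_quadratic_conj_algebra (base_field :: ('k::field, 'k) conj_alg)"
  by (rule assoc_quadratic_conj_algebra.intro, rule quadratic_conj_algebra.intro,
      rule k_conj_algebra_base_field, rule quadratic_conj_algebra_axioms.intro)
    (auto simp: base_field_def incl_def nrm_def assoc_quadratic_conj_algebra_axioms_def
      algebra_simps)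

text \<open>With the identity as conjugation the product is \<open>(a c + D d b, a d + c b)\<close>,
  symmetric under exchanging the factors.\<close>

lemma mul_base_field_double_commute:
  "mul (cd_double base_field D) x y = mul (cd_double base_field D) y x"
  by (cases x; cases y) (simp add: cd_double_simps base_field_def mult.commute add.commute)

theorem corollary3:
  fixes D\<^sub>1 D\<^sub>2 D\<^sub>3 :: "'k::field"
  assumes "k\<^sub>0 = (base_field :: ('k, 'k) conj_alg)"
    and "k\<^sub>1 = cd_double k\<^sub>0 D\<^sub>1"
    and "k\<^sub>2 = cd_double k\<^sub>1 D\<^sub>2"
    and "k\<^sub>3 = cd_double k\<^sub>2 D\<^sub>3"
  shows "(\<forall>a b. nrm k\<^sub>1 (mul k\<^sub>1 a b) = mul k\<^sub>1 (nrm k\<^sub>1 a) (nrm k\<^sub>1 b)) \<and>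
         (\<forall>a b. nrm k\<^sub>2 (mul k\<^sub>2 a b) = mul k\<^sub>2 (nrm k\<^sub>2 a) (nrm k\<^sub>2 b)) \<and>
         (\<forall>a b. nrm k\<^sub>3 (mul k\<^sub>3 a b) = mul k\<^sub>3 (nrm k\<^sub>3 a) (nrm k\<^sub>3 b))"
proof -
  have k0: "assoc_quadratic_conj_algebra k\<^sub>0"
    unfolding assms(1) by (rule assoc_quadratic_base_field)
  have k1: "assoc_quadratic_conj_algebra k\<^sub>1"
    unfolding assms(2)
    by (rule assoc_quadratic_conj_algebra.assoc_quadratic_cd_double[OF k0])
      (simp add: assms(1) base_field_def mult.commute)
  have k2: "assoc_quadratic_conj_algebra k\<^sub>2"
    unfolding assms(3)
    by (rule assoc_quadratic_conj_algebra.assoc_quadratic_cd_double[OF k1])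
      (simp only: assms(1,2) mul_base_field_double_commute)
  \<comment> \<open>Each norm is multiplicative because the algebra one level below is associative;
    for \<open>k\<^sub>3\<close> this is \<open>k2\<close>.\<close>
  show ?thesis
    using assoc_quadratic_conj_algebra.nrm_cd_double_mul[OF k0, of D\<^sub>1]
      assoc_quadratic_conj_algebra.nrm_cd_double_mul[OF k1, of D\<^sub>2]
      assoc_quadratic_conj_algebra.nrm_cd_double_mul[OF k2, of D\<^sub>3]
    unfolding assms(2)[symmetric] assms(3)[symmetric] assms(4)[symmetric] by blast
qed

end
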